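(* Let $q,a,b$ be nonzero real numbers with $q\neq\pm1$, and suppose $b\neq q^{-j}$ and $a^{-1}b\neq q^{j}$ for every integer $j\ge 0$. Consider the operators acting on real functions $f(x)$ of a real variable $x$ (in particular on real polynomials) $$X f(x)=(x-q)f(q^{-1}x)+(q-bx)f(x),\qquad Yf(x)=(x-a^{-1}q)f(qx)+(a^{-1}q-b^{-1}x)f(x).$$ Then for each integer $n\ge 0$, the monic polynomial solution $P_n(x)$ of degree $n$ of the generalized eigenvalue problem $$Y P_n(x)=\lambda_n X P_n(x),\qquad \lambda_n\in\mathbb{R},$$ is the Pastro polynomial $$P_n(x)=P_n(x;a,b;q)=\frac{(a^{-1}bq^{1-n};q)_n\,(q;q)_n}{(q^{-n};q)_n\,(b;q)_n}\;{}_2\phi_1\!\left({q^{-n},\,b\atop a^{-1}bq^{1-n}};q,x\right),$$ and the eigenvalue is $\lambda_n=-b^{-1}q^{n}$. That is, a monic real polynomial $P$ of degree $n$ and a real number $\lambda$ satisfy $YP=\lambda XP$ if and only if $P=P_n(x;a,b;q)$ and $\lambda=-b^{-1}q^n$.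
   Context: The $q$-Pochhammer symbol is $(z;q)_0=1$, $(z;q)_k=\prod_{i=0}^{k-1}(1-zq^i)$ for $k\ge1$. The terminating $q$-hypergeometric series is $${}_2\phi_1\!\left({q^{-n},\beta\atop \gamma};q,x\right)=\sum_{k=0}^{n}\frac{(q^{-n};q)_k(\beta;q)_k}{(\gamma;q)_k(q;q)_k}x^k .$$ *)

theory Defs
  imports Complex_Main "HOL-Computational_Algebra.Polynomial"
begin

definition qpochhammer :: "real \<Rightarrow> real \<Rightarrow> nat \<Rightarrow> real" where
  "qpochhammer z q k = (\<Prod>i<k. 1 - z * q ^ i)"

text \<open>The terminating series with upper parameters $q^{-n}, \beta$ and lower parameter $\gamma$;
  the natural number \<open>n\<close> is the argument, rather than $q^{-n}$.\<close>

definition phi21 :: "nat \<Rightarrow> real \<Rightarrow> real \<Rightarrow> real \<Rightarrow> real \<Rightarrow> real" where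
  "phi21 n \<beta> \<gamma> q x =
     (\<Sum>k\<le>n. qpochhammer (q powi (- int n)) q k * qpochhammer \<beta> q k
              / (qpochhammer \<gamma> q k * qpochhammer q q k) * x ^ k)"

definition X_op :: "real \<Rightarrow> real \<Rightarrow> (real \<Rightarrow> real) \<Rightarrow> real \<Rightarrow> real" where
  "X_op q b f = (\<lambda>x. (x - q) * f (inverse q * x) + (q - b * x) * f x)"

definition Y_op :: "real \<Rightarrow> real \<Rightarrow> real \<Rightarrow> (real \<Rightarrow> real) \<Rightarrow> real \<Rightarrow> real" where
  "Y_op q a b f =
     (\<lambda>x. (x - inverse a * q) * f (q * x) + (inverse a * q - inverse b * x) * f x)"

definition pastro :: "nat \<Rightarrow> real \<Rightarrow> real \<Rightarrow> real \<Rightarrow> real \<Rightarrow> real" where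
  "pastro n a b q x =
     qpochhammer (inverse a * b * q powi (1 - int n)) q n * qpochhammer q q n
       / (qpochhammer (q powi (- int n)) q n * qpochhammer b q n)
     * phi21 n b (inverse a * b * q powi (1 - int n)) q x"

definition monic_of_degree :: "nat \<Rightarrow> real poly \<Rightarrow> bool" where
  "monic_of_degree n P \<longleftrightarrow> degree P = n \<and> lead_coeff P = 1"

end

theory Submission
  imports Defs
begin

text \<open>Both operators send \<open>x ^ k\<close> into the span of \<open>x ^ k\<close> and \<open>x ^ (k + 1)\<close>, so the eigenvalue
  equation is a two-term recurrence for the coefficients. Its top instance forces the eigenvalue;
  for that eigenvalue the recurrence is the one satisfied by the terms of the \<open>q\<close>-hypergeometric
  series, and the hypotheses on \<open>b\<close> let it be solved downwards from the leading coefficient.\<close>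

lemma qpochhammer_0 [simp]: "qpochhammer z q 0 = 1"
  by (simp add: qpochhammer_def)

lemma qpochhammer_Suc: "qpochhammer z q (Suc k) = qpochhammer z q k * (1 - z * q ^ k)"
  by (simp add: qpochhammer_def)

lemma qpochhammer_eq_0_iff: "qpochhammer z q k = 0 \<longleftrightarrow> (\<exists>i<k. z * q ^ i = 1)"
  by (auto simp: qpochhammer_def)

lemma real_power_neq_1:
  fixes q :: real
  assumes "q \<noteq> 1" "q \<noteq> -1" "k \<noteq> 0"
  shows "q ^ k \<noteq> 1"
  using assms by (auto dest!: power_eq_1_iff)

lemma real_power_inject:
  fixes q :: real
  assumes "q \<noteq> 0" "q \<noteq> 1" "q \<noteq> -1" "q ^ m = q ^ k"
  shows "m = k"
proof -
  have "q ^ i \<noteq> q ^ j" if "i < j" for i j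
  proof -
    have "q ^ j = q ^ i * q ^ (j - i)"
      using that by (simp flip: power_add)
    moreover have "q ^ (j - i) \<noteq> 1"
      using that assms(2,3) by (intro real_power_neq_1) auto
    ultimately show ?thesis
      using assms(1) by simp
  qed
  then show ?thesis
    using assms(4) by (metis linorder_neqE_nat)
qed

text \<open>Replacing \<open>x\<close> by \<open>q * x\<close> multiplies the coefficient of
  \<open>x ^ k\<close> by \<open>q ^ k\<close>, so both sides are polynomials, and equality as real
  functions is equality of coefficients. Instance \<open>k\<close> compares the coefficients of
  \<open>x ^ Suc k\<close>.\<close>

lemma eigen_iff_coeffs:
  fixes P :: "real poly"
  assumes "q \<noteq> 0"
  shows "Y_op q a b (poly P) = (\<lambda>x. l * X_op q b (poly P) x) \<longleftrightarrow>
    (\<forall>k. (q ^ k - inverse b) * coeff P k + inverse a * q * (1 - q ^ Suc k) * coeff P (Suc k)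
       = l * ((inverse q ^ k - b) * coeff P k + q * (1 - inverse q ^ Suc k) * coeff P (Suc k)))"
    (is "_ \<longleftrightarrow> ?rec")
proof -
  define Y where "Y = [:- inverse a * q, 1:] * pcompose P [:0, q:] + [:inverse a * q, - inverse b:] * P"
  define X where "X = [:- q, 1:] * pcompose P [:0, inverse q:] + [:q, - b:] * P"
  have "Y_op q a b (poly P) = poly Y"
    by (simp add: fun_eq_iff Y_op_def Y_def poly_pcompose algebra_simps)
  moreover have "(\<lambda>x. l * X_op q b (poly P) x) = poly (smult l X)"
    by (simp add: fun_eq_iff X_op_def X_def poly_pcompose algebra_simps)
  \<comment> \<open>Both constant coefficients are 0 by cancellation, so degree 0 imposes no
    condition.\<close>
  moreover have "coeff Y 0 = coeff (smult l X) 0"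
    by (simp add: X_def Y_def coeff_pcompose_linear poly_0_coeff_0)
  moreover have "(\<forall>k. coeff Y (Suc k) = coeff (smult l X) (Suc k)) \<longleftrightarrow> ?rec"
    by (simp add: X_def Y_def coeff_pcompose_linear algebra_simps)
  moreover have "Y = smult l X \<longleftrightarrow> coeff Y 0 = coeff (smult l X) 0 \<and>
      (\<forall>k. coeff Y (Suc k) = coeff (smult l X) (Suc k))"
    unfolding poly_eq_iff by (metis not0_implies_Suc)
  ultimately show ?thesis
    by (simp only: poly_eq_poly_eq_iff simp_thms)
qed

text \<open>At \<open>k = n\<close> only the leading coefficient 1 survives, leaving a linear
  equation for \<open>l\<close>; it is solvable uniquely because
  \<open>b * q ^ n \<noteq> 1\<close>.\<close>

lemma eigenvalue_unique:
  fixes P :: "real poly"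
  assumes "q \<noteq> 0" "b \<noteq> 0" "b * q ^ n \<noteq> 1" "monic_of_degree n P"
    and "Y_op q a b (poly P) = (\<lambda>x. l * X_op q b (poly P) x)"
  shows "l = - inverse b * q ^ n"
proof -
  have "coeff P n = 1" "coeff P (Suc n) = 0"
    using assms(4) by (auto simp: monic_of_degree_def coeff_eq_0)
  then have "q ^ n - inverse b = l * (inverse q ^ n - b)"
    using assms(5)[unfolded eigen_iff_coeffs[OF assms(1)], rule_format, of n] by simp
  then have "(b * q ^ n - 1) * (l * b + q ^ n) = 0"
    using assms(1,2) by (simp add: field_simps)
  then have "l * b + q ^ n = 0"
    using assms(3) by simp
  then show ?thesis
    using assms(2) by (simp add: field_simps eq_neg_iff_add_eq_0)
qed

lemma eigen_iff_recurrence: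
  fixes P :: "real poly"
  assumes "q \<noteq> 0" "b \<noteq> 0"
  shows "Y_op q a b (poly P) = (\<lambda>x. - inverse b * q ^ n * X_op q b (poly P) x) \<longleftrightarrow>
    (\<forall>k. coeff P k * ((1 - b * q ^ k) * (q ^ n - q ^ k))
       = coeff P (Suc k) * ((1 - q ^ Suc k) * (q ^ n - inverse a * b * q ^ Suc k)))"
proof -
  have "(q ^ k - inverse b) * c + inverse a * q * (1 - q ^ Suc k) * d
       = - inverse b * q ^ n * ((inverse q ^ k - b) * c + q * (1 - inverse q ^ Suc k) * d)
     \<longleftrightarrow> c * ((1 - b * q ^ k) * (q ^ n - q ^ k))
       = d * ((1 - q ^ Suc k) * (q ^ n - inverse a * b * q ^ Suc k))"
    for c d :: real and k
  proof -
    \<comment> \<open>For this eigenvalue both coefficients factor, and the two differences agree up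
      to the nonzero factor \<open>inverse b * inverse q ^ k\<close>.\<close>
    have "(q ^ k - inverse b) * c + inverse a * q * (1 - q ^ Suc k) * d
       - (- inverse b * q ^ n * ((inverse q ^ k - b) * c + q * (1 - inverse q ^ Suc k) * d))
     = inverse b * inverse q ^ k * (c * ((1 - b * q ^ k) * (q ^ n - q ^ k))
       - d * ((1 - q ^ Suc k) * (q ^ n - inverse a * b * q ^ Suc k)))"
      \<comment> \<open>Clearing \<open>inverse a\<close> requires \<open>a \<noteq> 0\<close>; at
        \<open>a = 0\<close> it has the default value 0.\<close>
      using assms by (cases "a = 0") (simp_all add: field_simps)
    then show ?thesis
      using assms by (metis eq_iff_diff_eq_0 inverse_zero_imp_zero mult_eq_0_iff power_not_zero)
  qed
  then show ?thesis
    unfolding eigen_iff_coeffs[OF assms(1)] by (simp only:)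
qed

text \<open>Downward induction from \<open>n\<close>: dividing by \<open>u k\<close> determines the
  value at \<open>k\<close> from the one at \<open>Suc k\<close>.\<close>

lemma recurrence_unique:
  fixes c d u v :: "nat \<Rightarrow> real"
  assumes "\<And>k. k < n \<Longrightarrow> c k * u k = c (Suc k) * v k"
    and "\<And>k. k < n \<Longrightarrow> d k * u k = d (Suc k) * v k"
    and "\<And>k. k < n \<Longrightarrow> u k \<noteq> 0" and "c n = d n" and "k \<le> n"
  shows "c k = d k"
  using assms(5)
proof (induction rule: inc_induct)
  case (step m)
  then show ?case
    using assms(1-3)[of m] by (metis mult_right_cancel)
qed (use assms(4) in simp)

text \<open>The prefactor is the reciprocal of the bracketed ratio at \<open>k = n\<close>, which
  normalises the leading coefficient to 1.\<close>

definition pastro_coeff :: "nat \<Rightarrow> real \<Rightarrow> real \<Rightarrow> real \<Rightarrow> nat \<Rightarrow> real" where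
  "pastro_coeff n a b q k =
     qpochhammer (inverse a * b * q powi (1 - int n)) q n * qpochhammer q q n
       / (qpochhammer (q powi (- int n)) q n * qpochhammer b q n)
     * (qpochhammer (q powi (- int n)) q k * qpochhammer b q k
         / (qpochhammer (inverse a * b * q powi (1 - int n)) q k * qpochhammer q q k))"

definition pastro_poly :: "nat \<Rightarrow> real \<Rightarrow> real \<Rightarrow> real \<Rightarrow> real poly" where
  "pastro_poly n a b q = (\<Sum>k\<le>n. monom (pastro_coeff n a b q k) k)"

lemma poly_pastro_poly: "poly (pastro_poly n a b q) = pastro n a b q"
  by (simp add: fun_eq_iff pastro_poly_def pastro_def phi21_def pastro_coeff_def poly_sum
      poly_monom sum_distrib_left mult.assoc)

lemma coeff_pastro_poly:
  "coeff (pastro_poly n a b q) k = (if k \<le> n then pastro_coeff n a b q k else 0)"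
  by (simp add: pastro_poly_def coeff_sum)

context
  fixes q a b :: real
  assumes q: "q \<noteq> 0" "q \<noteq> 1" "q \<noteq> -1"
    and b_neq: "\<And>j::nat. b \<noteq> q powi (- int j)"
    and ab_neq: "\<And>j::nat. inverse a * b \<noteq> q ^ j"
begin

lemma b_power_neq: "b * q ^ k \<noteq> 1"
  using b_neq[of k] q by (auto simp: power_int_minus field_simps)

text \<open>This and \<open>ab_powi_factor\<close> identify q-Pochhammer factors, scaled by the same
  \<open>q ^ n\<close>, with factors of the recurrence.\<close>

lemma powi_factor: "q ^ n * (1 - q powi (- int n) * q ^ k) = q ^ n - q ^ k"
  using q by (simp add: power_int_minus field_simps)

lemma ab_powi_factor:
  "q ^ n * (1 - inverse a * b * q powi (1 - int n) * q ^ k) = q ^ n - inverse a * b * q ^ Suc k"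
  using q by (simp add: power_int_diff field_simps)

text \<open>Cancelling \<open>q ^ Suc k\<close> would make \<open>inverse a * b\<close> the power
  \<open>q ^ (n - Suc k)\<close>, whose exponent is nonnegative because
  \<open>k < n\<close>.\<close>

lemma ab_power_neq:
  assumes "k < n"
  shows "q ^ n \<noteq> inverse a * b * q ^ Suc k"
proof
  assume "q ^ n = inverse a * b * q ^ Suc k"
  moreover have "q ^ n = q ^ (n - Suc k) * q ^ Suc k"
    using assms by (metis Suc_leI le_add_diff_inverse2 power_add)
  ultimately show False
    using ab_neq[of "n - Suc k"] q by (metis mult_right_cancel power_not_zero)
qed

text \<open>The bound \<open>k \<le> n\<close> matters: the factor of index \<open>n\<close> of the
  first symbol is 0, and later factors of the third lead to negative powers of \<open>q\<close>,
  which \<open>ab_neq\<close> does not exclude.\<close>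

lemma qpochhammer_neq_0:
  assumes "k \<le> n"
  shows "qpochhammer (q powi (- int n)) q k \<noteq> 0" "qpochhammer b q k \<noteq> 0"
    "qpochhammer (inverse a * b * q powi (1 - int n)) q k \<noteq> 0" "qpochhammer q q k \<noteq> 0"
proof -
  show "qpochhammer (q powi (- int n)) q k \<noteq> 0"
    unfolding qpochhammer_eq_0_iff
    using powi_factor[of n] real_power_inject[OF q] assms
    by (metis eq_iff_diff_eq_0 mult_zero_right less_le_trans less_irrefl)
  show "qpochhammer b q k \<noteq> 0"
    using b_power_neq by (auto simp: qpochhammer_eq_0_iff)
  show "qpochhammer (inverse a * b * q powi (1 - int n)) q k \<noteq> 0"
    unfolding qpochhammer_eq_0_iff
    using ab_powi_factor[of n] ab_power_neq[of _ n] assms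
    by (metis eq_iff_diff_eq_0 mult_zero_right less_le_trans)
  show "qpochhammer q q k \<noteq> 0"
    using real_power_neq_1[OF q(2,3), of "Suc _"] by (auto simp: qpochhammer_eq_0_iff)
qed

lemma monic_pastro_poly: "monic_of_degree n (pastro_poly n a b q)"
proof -
  have "pastro_coeff n a b q n = 1"
    using qpochhammer_neq_0[of n n] by (simp add: pastro_coeff_def)
  then have "coeff (pastro_poly n a b q) n = 1"
    by (simp add: coeff_pastro_poly)
  moreover from this have "degree (pastro_poly n a b q) = n"
    by (intro antisym degree_le le_degree) (simp_all add: coeff_pastro_poly)
  ultimately show ?thesis
    by (simp add: monic_of_degree_def)
qed

lemma pastro_coeff_recurrence:
  assumes "k < n"
  shows "pastro_coeff n a b q k * ((1 - b * q ^ k) * (q ^ n - q ^ k))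
       = pastro_coeff n a b q (Suc k) * ((1 - q ^ Suc k) * (q ^ n - inverse a * b * q ^ Suc k))"
proof -
  let ?A = "q powi (- int n)" and ?G = "inverse a * b * q powi (1 - int n)"
  \<comment> \<open>Consecutive coefficients differ by one new factor in each symbol:
    \<open>x\<close>, \<open>y\<close> above and \<open>z\<close>, \<open>w\<close> below. The scale
    \<open>r\<close> stands for \<open>q ^ n\<close>.\<close>
  have ratio: "C * (A * B / (G * Q)) * (y * (r * x)) =
      C * (A * x * (B * y) / (G * z * (Q * w))) * (w * (r * z))"
    if "z \<noteq> 0" "w \<noteq> 0" for C A B G Q x y z w r :: real
    using that by simp
  have "1 - ?G * q ^ k \<noteq> 0" "1 - q * q ^ k \<noteq> 0"
    using qpochhammer_neq_0(3,4)[of "Suc k" n] assms by (simp_all add: qpochhammer_Suc)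
  then show ?thesis
    unfolding pastro_coeff_def qpochhammer_Suc power_Suc[of q k, symmetric]
      powi_factor[symmetric] ab_powi_factor[symmetric]
    by (intro ratio) simp_all
qed

lemma pastro_poly_recurrence:
  "coeff (pastro_poly n a b q) k * ((1 - b * q ^ k) * (q ^ n - q ^ k))
   = coeff (pastro_poly n a b q) (Suc k) * ((1 - q ^ Suc k) * (q ^ n - inverse a * b * q ^ Suc k))"
proof (cases k n rule: linorder_cases)
  case less
  then show ?thesis
    using pastro_coeff_recurrence[OF less] by (simp add: coeff_pastro_poly)
\<comment> \<open>At \<open>k = n\<close> the factor \<open>q ^ n - q ^ k\<close> and the next
  coefficient vanish; beyond \<open>n\<close> both coefficients are 0.\<close>
qed (simp_all add: coeff_pastro_poly)

end

theorem proposition3p1: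
  fixes q a b :: real and n :: nat
  assumes "q \<noteq> 0" and "a \<noteq> 0" and "b \<noteq> 0"
    and "q \<noteq> 1" and "q \<noteq> -1"
    and "\<And>j::nat. b \<noteq> q powi (- int j)"
    and "\<And>j::nat. inverse a * b \<noteq> q ^ j"
  shows "(\<exists>P. monic_of_degree n P \<and> poly P = pastro n a b q) \<and>
         (\<forall>P (l::real). monic_of_degree n P \<longrightarrow>
            (Y_op q a b (poly P) = (\<lambda>x. l * X_op q b (poly P) x)
             \<longleftrightarrow> poly P = pastro n a b q \<and> l = - inverse b * q ^ n))"
proof (intro conjI allI impI)
  note hyps = assms(1,4-7)
  let ?R = "pastro_poly n a b q"
  show "\<exists>P. monic_of_degree n P \<and> poly P = pastro n a b q"
    using monic_pastro_poly[OF hyps] poly_pastro_poly by blast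
  fix P and l :: real
  assume P: "monic_of_degree n P"
  show "Y_op q a b (poly P) = (\<lambda>x. l * X_op q b (poly P) x)
    \<longleftrightarrow> poly P = pastro n a b q \<and> l = - inverse b * q ^ n" (is "?eigen \<longleftrightarrow> ?P \<and> ?l")
  proof
    assume eigen: ?eigen
    then have l: ?l
      using eigenvalue_unique[OF assms(1,3) b_power_neq[OF hyps] P] by blast
    have rec: "coeff P k * ((1 - b * q ^ k) * (q ^ n - q ^ k))
       = coeff P (Suc k) * ((1 - q ^ Suc k) * (q ^ n - inverse a * b * q ^ Suc k))" for k
      using eigen eigen_iff_recurrence[OF assms(1,3)] unfolding l by blast
    have neq: "(1 - b * q ^ k) * (q ^ n - q ^ k) \<noteq> 0" if "k < n" for k
      using that b_power_neq[OF hyps, of k] real_power_inject[OF assms(1,4,5), of n k] by auto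
    \<comment> \<open>Both polynomials are monic, so the downward recurrence starts from the same
      value.\<close>
    have top: "coeff P n = coeff ?R n"
      using P monic_pastro_poly[OF hyps, of n] by (auto simp: monic_of_degree_def)
    have "coeff P k = coeff ?R k" if "k \<le> n" for k
      by (rule recurrence_unique[where u = "\<lambda>k. (1 - b * q ^ k) * (q ^ n - q ^ k)",
            OF rec pastro_poly_recurrence[OF hyps] neq top that])
    moreover have "coeff P k = coeff ?R k" if "k > n" for k
      using that P by (auto simp: monic_of_degree_def coeff_pastro_poly coeff_eq_0)
    ultimately have "P = ?R"
      by (metis poly_eqI not_le)
    with l show "?P \<and> ?l"
      by (simp add: poly_pastro_poly)
  next
    assume "?P \<and> ?l"
    \<comment> \<open>A real polynomial is determined by its function, so the recurrence for
      \<open>?R\<close> transfers to \<open>P\<close>.\<close>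
    then have "P = ?R" ?l
      by (simp_all add: poly_pastro_poly flip: poly_eq_poly_eq_iff)
    then show ?eigen
      using eigen_iff_recurrence[OF assms(1,3)] pastro_poly_recurrence[OF hyps] by blast
  qed
qed

end
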